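(* Let $A_1,\dots,A_m:\mathcal H\rightrightarrows\mathcal H$ be set-valued operators on $\mathcal H$, and let $\lambda_1,\dots,\lambda_{m-1}\in\mathbb R$ with $\sum_{i=1}^{m-1}\lambda_i=1$. Define $\mathbf F,\mathbf K,\mathbf G:\mathcal H^{m-1}\rightrightarrows\mathcal H^{m-1}$ by $$\mathbf F(\mathbf x)=A_1(x_1)\times\cdots\times A_{m-1}(x_{m-1}),$$ $$\mathbf K(\mathbf x)=\begin{cases}\{(\lambda_1v,\dots,\lambda_{m-1}v):v\in A_m(x_1)\}&\text{if }\mathbf x=(x_1,\dots,x_{m-1})\in\mathbf D_{m-1},\\ \emptyset&\text{otherwise,}\end{cases}$$ $$\mathbf G(\mathbf x)=\mathbf K(\mathbf x)+N_{\mathbf D_{m-1}}(\mathbf x).$$ Then $$\operatorname{zer}(\mathbf F+\mathbf G)=\boldsymbol\Delta_{m-1}\Big(\operatorname{zer}\Big(\sum_{i=1}^mA_i\Big)\Big).$$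
   Context: $\mathcal H$ is a real Hilbert space, $m\ge2$. For a set-valued operator $A$, $\operatorname{zer}A=\{x:0\in A(x)\}$; sums of set-valued operators are pointwise Minkowski sums (empty if a summand is empty). $\mathcal H^{m-1}$ has inner product $\langle\mathbf x,\mathbf y\rangle=\sum_{i=1}^{m-1}\langle x_i,y_i\rangle$. $\mathbf D_{m-1}=\{\mathbf x\in\mathcal H^{m-1}:x_1=\cdots=x_{m-1}\}$; its normal cone is $N_{\mathbf D_{m-1}}(\mathbf x)=\mathbf D_{m-1}^\perp=\{\mathbf w:\sum_{i=1}^{m-1}w_i=0\}$ if $\mathbf x\in\mathbf D_{m-1}$ and $\emptyset$ otherwise. $\boldsymbol\Delta_{m-1}:\mathcal H\to\mathcal H^{m-1}$ is $x\mapsto(x,\dots,x)$. *)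

theory Defs
  imports "HOL-Analysis.Analysis" "HOL-Library.Set_Algebras"
begin

text \<open>
  A set-valued operator is a function \<^typ>\<open>'a \<Rightarrow> 'a set\<close>.  The sum of two sets is the
  Minkowski sum of \<^theory>\<open>HOL-Library.Set_Algebras\<close>, which is empty if a summand is.
  The power \<open>H^(m-1)\<close> is the inner product space \<open>'a ^ 'n\<close> with \<open>CARD('n) = m - 1\<close>;
  as \<open>'n\<close> is nonempty, this is \<open>m \<ge> 2\<close>.
\<close>

definition zer :: "('a::zero \<Rightarrow> 'a set) \<Rightarrow> 'a set"
  where "zer A = {x. 0 \<in> A x}"

definition op_plus :: "('a \<Rightarrow> 'b::plus set) \<Rightarrow> ('a \<Rightarrow> 'b set) \<Rightarrow> 'a \<Rightarrow> 'b set"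
  (infixl "\<oplus>\<^sub>o" 65)
  where "(A \<oplus>\<^sub>o B) x = A x + B x"

definition op_sum :: "('i \<Rightarrow> 'a \<Rightarrow> 'b::comm_monoid_add set) \<Rightarrow> 'i set \<Rightarrow> 'a \<Rightarrow> 'b set"
  where "op_sum A I x = (\<Sum>i\<in>I. A i x)"

definition normal_cone :: "'a::real_inner set \<Rightarrow> 'a \<Rightarrow> 'a set"
  where "normal_cone C x = (if x \<in> C then {w. \<forall>y\<in>C. w \<bullet> (y - x) \<le> 0} else {})"

definition diagonal :: "('a ^ 'n) set"
  where "diagonal = {x. \<forall>i j. x $ i = x $ j}"

definition diag_emb :: "'a \<Rightarrow> 'a ^ 'n"
  where "diag_emb x = (\<chi> i. x)"

definition op_F :: "('n \<Rightarrow> 'a \<Rightarrow> 'a set) \<Rightarrow> 'a ^ 'n \<Rightarrow> ('a ^ 'n) set"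
  where "op_F A x = {w. \<forall>i. w $ i \<in> A i (x $ i)}"

text \<open>
  An index type has no canonical first element, so the index \<open>k\<close> at which \<open>x\<close> is read off
  (the first one in \<open>A\<^sub>m(x\<^sub>1)\<close>) is a parameter.
\<close>

definition op_K ::
    "'n \<Rightarrow> ('n \<Rightarrow> real) \<Rightarrow> ('a::real_vector \<Rightarrow> 'a set) \<Rightarrow> 'a ^ 'n \<Rightarrow> ('a ^ 'n) set"
  where "op_K k l B x = (if x \<in> diagonal then {(\<chi> i. l i *\<^sub>R v) | v. v \<in> B (x $ k)} else {})"

definition op_G ::
    "'n::finite \<Rightarrow> ('n \<Rightarrow> real) \<Rightarrow> ('a::real_inner \<Rightarrow> 'a set) \<Rightarrow> 'a ^ 'n \<Rightarrow> ('a ^ 'n) set"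
  where "op_G k l B = op_K k l B \<oplus>\<^sub>o normal_cone diagonal"

lemma orthogonal_comp_diagonal:
  "orthogonal_comp (diagonal :: ('a::real_inner ^ 'n::finite) set) = {w. (\<Sum>i\<in>UNIV. w $ i) = 0}"
proof (intro equalityI subsetI CollectI)
  fix w :: "'a ^ 'n"
  let ?s = "\<Sum>i\<in>UNIV. w $ i"
  assume "w \<in> orthogonal_comp diagonal"
  moreover have "(\<chi> i. ?s) \<in> (diagonal :: ('a ^ 'n) set)"
    by (simp add: diagonal_def)
  ultimately have "(\<chi> i. ?s) \<bullet> w = 0"
    unfolding orthogonal_comp_def orthogonal_def by blast
  then have "?s \<bullet> ?s = 0"
    by (simp add: inner_vec_def inner_sum_right)
  then show "?s = 0" by simp
next
  fix w :: "'a ^ 'n"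
  assume "w \<in> {w. (\<Sum>i\<in>UNIV. w $ i) = 0}"
  then have s: "(\<Sum>i\<in>UNIV. w $ i) = 0" by simp
  have "y \<bullet> w = 0" if "y \<in> diagonal" for y :: "'a ^ 'n"
  proof -
    define u where "u = y $ undefined"
    have y: "y $ i = u" for i
      using that unfolding diagonal_def u_def by blast
    have "y \<bullet> w = u \<bullet> (\<Sum>i\<in>UNIV. w $ i)"
      unfolding inner_vec_def inner_sum_right y ..
    then show ?thesis using s by simp
  qed
  then show "w \<in> orthogonal_comp diagonal"
    by (simp add: orthogonal_comp_def orthogonal_def)
qed

lemma normal_cone_diagonal:
  "normal_cone diagonal (x :: 'a::real_inner ^ 'n::finite) =
     (if x \<in> diagonal then orthogonal_comp diagonal else {})"
proof (cases "x \<in> diagonal")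
  case True
  have "(\<forall>y\<in>diagonal. w \<bullet> (y - x) \<le> 0) \<longleftrightarrow> (\<forall>y\<in>diagonal. y \<bullet> w = 0)" for w
  proof (intro iffI ballI)
    fix y :: "'a ^ 'n"
    assume le: "\<forall>y\<in>diagonal. w \<bullet> (y - x) \<le> 0" and y: "y \<in> diagonal"
    have xy: "x $ i = x $ j" "y $ i = y $ j" for i j
      using True y unfolding diagonal_def by blast+
    have "x + y \<in> diagonal"
      unfolding diagonal_def mem_Collect_eq vector_add_component
      by (intro allI arg_cong2[where f = "(+)"] xy)
    moreover have "x - y \<in> diagonal"
      unfolding diagonal_def mem_Collect_eq vector_minus_component
      by (intro allI arg_cong2[where f = "(-)"] xy)
    ultimately have "w \<bullet> (x + y - x) \<le> 0" "w \<bullet> (x - y - x) \<le> 0"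
      using le by blast+
    then show "y \<bullet> w = 0" by (simp add: inner_commute)
  next
    fix y :: "'a ^ 'n"
    assume "\<forall>y\<in>diagonal. y \<bullet> w = 0" "y \<in> diagonal"
    then have "y \<bullet> w = 0" "x \<bullet> w = 0"
      using True by blast+
    then show "w \<bullet> (y - x) \<le> 0"
      by (simp add: inner_diff_right inner_commute)
  qed
  then show ?thesis
    using True by (simp add: normal_cone_def orthogonal_comp_def orthogonal_def)
qed (simp add: normal_cone_def)

end

theory Submission
  imports Defs
begin

text \<open>
  The weights disappear from \<open>G\<close>: because they sum to \<open>1\<close>, the \<open>m - 1\<close> coordinates \<open>\<lambda>\<^sub>i v\<close> add up to
  \<open>v\<close>, and adding the normal cone, which on the diagonal consists of the vectors with coordinate sum
  zero, leaves nothing but this sum.  So \<open>w\<close> lies in \<open>G (u, \<dots>, u)\<close> iff \<open>\<Sum>\<^sub>i w\<^sub>i\<close> lies in \<open>A\<^sub>m u\<close>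
  (lemma \<open>mem_op_G_iff\<close>), and \<open>G\<close> is empty off the diagonal.  A zero of \<open>F + G\<close> is therefore a point
  \<open>(u, \<dots>, u)\<close> for which there are \<open>w\<^sub>i \<in> A\<^sub>i u\<close> with \<open>- \<Sum>\<^sub>i w\<^sub>i \<in> A\<^sub>m u\<close>, which says that \<open>u\<close> is a
  zero of the sum of all the operators.
\<close>

lemma mem_diagonal_iff: "x \<in> diagonal \<longleftrightarrow> (\<exists>u. x = diag_emb u)"
  unfolding diagonal_def diag_emb_def vec_eq_iff by auto

lemma zero_mem_set_plus_iff:
  fixes S T :: "'a::ab_group_add set"
  shows "0 \<in> S + T \<longleftrightarrow> (\<exists>s\<in>S. - s \<in> T)"
  unfolding set_plus_def by (force simp: minus_unique intro: add.right_inverse[symmetric])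

text \<open>
  Taking coordinate sums recovers \<open>v\<close> from an element of \<open>K x + N x\<close>.  Conversely, a vector whose
  coordinate sum is \<open>v\<close> differs from \<open>(\<lambda>\<^sub>i v)\<^sub>i\<close> by a vector with coordinate sum zero, that is, by a
  normal vector of the diagonal.
\<close>

lemma mem_op_G_iff:
  fixes l :: "'n::finite \<Rightarrow> real" and B :: "'a::real_inner \<Rightarrow> 'a set"
  assumes l: "(\<Sum>i\<in>UNIV. l i) = 1"
  shows "w \<in> op_G k l B x \<longleftrightarrow> (\<exists>u. x = diag_emb u \<and> (\<Sum>i\<in>UNIV. w $ i) \<in> B u)"
proof -
  have sum_weights: "(\<Sum>i\<in>UNIV. l i *\<^sub>R v) = v" for v :: 'a
    using l by (simp flip: scaleR_sum_left)
  show ?thesis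
  proof
    assume "w \<in> op_G k l B x"
    then obtain v n where x: "x \<in> diagonal" and v: "v \<in> B (x $ k)"
      and w: "w = (\<chi> i. l i *\<^sub>R v) + n" and n: "(\<Sum>i\<in>UNIV. n $ i) = 0"
      unfolding op_G_def op_plus_def op_K_def normal_cone_diagonal orthogonal_comp_diagonal
      by (auto elim!: set_plus_elim split: if_splits)
    from x obtain u where u: "x = diag_emb u"
      unfolding mem_diagonal_iff by blast
    have "(\<Sum>i\<in>UNIV. w $ i) = v"
      using n by (simp add: w sum.distrib sum_weights)
    then show "\<exists>u. x = diag_emb u \<and> (\<Sum>i\<in>UNIV. w $ i) \<in> B u"
      using u v by (auto simp: diag_emb_def)
  next
    assume "\<exists>u. x = diag_emb u \<and> (\<Sum>i\<in>UNIV. w $ i) \<in> B u"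
    then obtain u where u: "x = diag_emb u" and w: "(\<Sum>i\<in>UNIV. w $ i) \<in> B u"
      by blast
    define v where "v = (\<Sum>i\<in>UNIV. w $ i)"
    define y where "y = (\<chi> i. l i *\<^sub>R v)"
    have x: "x \<in> diagonal"
      using u mem_diagonal_iff by blast
    have "y \<in> op_K k l B x"
      using x w by (auto simp: op_K_def y_def v_def u diag_emb_def)
    moreover have "w - y \<in> normal_cone diagonal x"
      using x by (simp add: normal_cone_diagonal orthogonal_comp_diagonal y_def sum_subtractf
          sum_weights flip: v_def)
    ultimately have "y + (w - y) \<in> op_K k l B x + normal_cone diagonal x"
      by (rule set_plus_intro)
    then show "w \<in> op_G k l B x"
      by (simp add: op_G_def op_plus_def)
  qed
qed

theorem theorem3p3:
  fixes A :: "'n::finite \<Rightarrow> 'a::{real_inner, complete_space} \<Rightarrow> 'a set"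
    and A\<^sub>m :: "'a \<Rightarrow> 'a set"
    and l :: "'n \<Rightarrow> real"
    and k :: 'n
  assumes "(\<Sum>i\<in>UNIV. l i) = 1"
  shows "zer (op_F A \<oplus>\<^sub>o op_G k l A\<^sub>m) =
         (diag_emb :: 'a \<Rightarrow> 'a ^ 'n) ` zer (op_sum A UNIV \<oplus>\<^sub>o A\<^sub>m)"
proof -
  have zero_iff: "u \<in> zer (op_sum A UNIV \<oplus>\<^sub>o A\<^sub>m) \<longleftrightarrow>
      (\<exists>w \<in> op_F A (diag_emb u). - (\<Sum>i\<in>UNIV. w $ i) \<in> A\<^sub>m u)" for u
  proof -
    \<comment> \<open>The elements of \<open>F (u, \<dots>, u)\<close> are the possible choices of one summand from each \<open>A\<^sub>i u\<close>.\<close>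
    have "op_sum A UNIV u = (\<lambda>w. \<Sum>i\<in>UNIV. w $ i) ` op_F A (diag_emb u)"
    proof (intro equalityI subsetI)
      fix s assume "s \<in> op_sum A UNIV u"
      then obtain f where s: "s = (\<Sum>i\<in>UNIV. f i)" and f: "\<And>i. f i \<in> A i u"
        by (auto simp: op_sum_def set_sum_alt)
      then show "s \<in> (\<lambda>w. \<Sum>i\<in>UNIV. w $ i) ` op_F A (diag_emb u)"
        by (intro image_eqI[where x = "\<chi> i. f i"]) (auto simp: op_F_def diag_emb_def)
    qed (auto simp: op_sum_def set_sum_alt op_F_def diag_emb_def)
    then show ?thesis
      by (simp add: zer_def op_plus_def zero_mem_set_plus_iff)
  qed
  have "x \<in> zer (op_F A \<oplus>\<^sub>o op_G k l A\<^sub>m) \<longleftrightarrow>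
      (\<exists>u. x = diag_emb u \<and> u \<in> zer (op_sum A UNIV \<oplus>\<^sub>o A\<^sub>m))" for x
    unfolding zero_iff
    by (auto simp: zer_def op_plus_def zero_mem_set_plus_iff mem_op_G_iff[OF assms] sum_negf)
  then show ?thesis
    by auto
qed

end
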